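(* Let $M$ be an arbitrary $d\times d$ matrix dilation, $c\in\frac12\mathbb Z^d$, $n\in\mathbb N$, and let a mask $m_0$ be symmetric with respect to the point $c$ in the sense (a) (respectively, in the sense (b)) and have sum rule of order $n$ (with respect to $M$). Then there exists a mask $\widetilde m_0$ which is symmetric with respect to the point $c$ in the sense (a) (respectively, in the sense (b)) and satisfies $$D^\beta\big(1-m_0(\xi)\overline{\widetilde m_0(\xi)}\big)\Big|_{\xi=\mathbf 0}=0\qquad\forall\beta\in\Delta_n.$$
   Context: A matrix dilation $M$ is an integer $d\times d$ matrix all of whose eigenvalues are bigger than 1 in modulus; $M^*$ is its conjugate (transpose). $[\alpha]=\sum_j\alpha_j$, $\Delta_n=\{\alpha\in\mathbb Z^d_+:[\alpha]<n\}$. A mask is a trigonometric polynomial $m_0(\xi)=\sum_{k\in\mathbb Z^d}h_ke^{2\pi i(k,\xi)}$ (finite sum, $h_k\in\mathbb C$) with $m_0(\mathbf 0)=1$. A trigonometric polynomial $t$ is symmetric with respect to $c\in\frac12\mathbb Z^d$ in the sense (a) if $t(\xi)=e^{2\pi i(2c,\xi)}t(-\xi)$, and in the sense (b) if $t(\xi)=e^{2\pi i(2c,\xi)}\overline{t(\xi)}$, for $\xi\in\mathbb R^d$. $t$ has sum rule of order $n$ with respect to $M$ if $D^\beta(t(M^{*-1}\xi))|_{\xi=s}=0$ for all $s\in D(M^* )\setminus\{\mathbf 0\}$ and all $\beta\in\Delta_n$, where $D(M^* )$ is a complete set of representatives of $\mathbb Z^d/M^*\mathbb Z^d$ containing $\mathbf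 0$. *)

theory Defs
  imports "HOL-Analysis.Analysis"
begin

definition real_vec :: "int ^ 'd \<Rightarrow> real ^ 'd" where
  "real_vec k = (\<chi> i. of_int (k $ i))"

definition eigenvalue :: "complex ^ 'd ^ 'd \<Rightarrow> complex \<Rightarrow> bool" where
  "eigenvalue A z \<longleftrightarrow> (\<exists>v. v \<noteq> 0 \<and> A *v v = z *s v)"

definition matrix_dilation :: "int ^ 'd ^ 'd \<Rightarrow> bool" where
  "matrix_dilation M \<longleftrightarrow> (\<forall>z. eigenvalue (map_matrix of_int M) z \<longrightarrow> cmod z > 1)"

definition trig_poly :: "(real ^ 'd \<Rightarrow> complex) \<Rightarrow> bool" where
  "trig_poly t \<longleftrightarrow> (\<exists>h :: int ^ 'd \<Rightarrow> complex. finite {k. h k \<noteq> 0} \<and>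
     (\<forall>\<xi>. t \<xi> = (\<Sum>k | h k \<noteq> 0.
        h k * exp (2 * of_real pi * \<i> * of_real (real_vec k \<bullet> \<xi>)))))"

definition is_mask :: "(real ^ 'd \<Rightarrow> complex) \<Rightarrow> bool" where
  "is_mask t \<longleftrightarrow> trig_poly t \<and> t 0 = 1"

definition half_integer_point :: "real ^ 'd \<Rightarrow> bool" where
  "half_integer_point c \<longleftrightarrow> (\<exists>k. c = (1 / 2) *\<^sub>R real_vec k)"

definition symmetric_a :: "real ^ 'd \<Rightarrow> (real ^ 'd \<Rightarrow> complex) \<Rightarrow> bool" where
  "symmetric_a c t \<longleftrightarrow>
     (\<forall>\<xi>. t \<xi> = exp (2 * of_real pi * \<i> * of_real ((2 *\<^sub>R c) \<bullet> \<xi>)) * t (- \<xi>))"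

definition symmetric_b :: "real ^ 'd \<Rightarrow> (real ^ 'd \<Rightarrow> complex) \<Rightarrow> bool" where
  "symmetric_b c t \<longleftrightarrow>
     (\<forall>\<xi>. t \<xi> = exp (2 * of_real pi * \<i> * of_real ((2 *\<^sub>R c) \<bullet> \<xi>)) * cnj (t \<xi>))"

definition partial_deriv :: "'d \<Rightarrow> (real ^ 'd \<Rightarrow> complex) \<Rightarrow> real ^ 'd \<Rightarrow> complex" where
  "partial_deriv j f = (\<lambda>x. vector_derivative (\<lambda>u. f (x + u *\<^sub>R axis j 1)) (at 0))"

text \<open>
  The partial derivatives are composed in the order of the linearly ordered index type;
  the order is immaterial for the smooth functions considered here.
\<close>
definition multi_deriv ::
    "('d::{finite,linorder} \<Rightarrow> nat) \<Rightarrow> (real ^ ('d::{finite,linorder}) \<Rightarrow> complex) \<Rightarrow> real ^ ('d::{finite,linorder}) \<Rightarrow> complex" where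
  "multi_deriv \<beta> f =
     foldr (\<lambda>j. partial_deriv j ^^ \<beta> j) (sorted_list_of_set UNIV) f"

definition \<Delta> :: "nat \<Rightarrow> ('d::finite \<Rightarrow> nat) set" where
  "\<Delta> n = {\<beta>. (\<Sum>j\<in>UNIV. \<beta> j) < n}"

definition digits :: "int ^ 'd ^ 'd \<Rightarrow> (int ^ 'd) set \<Rightarrow> bool" where
  "digits A D \<longleftrightarrow> 0 \<in> D \<and> (\<forall>k. \<exists>!s. s \<in> D \<and> (\<exists>l. k - s = A *v l))"

text \<open>
  \<open>D\<close> is meant to satisfy \<open>digits (transpose M) D\<close>.
\<close>
definition sum_rule ::
    "int ^ ('d::{finite,linorder}) ^ ('d::{finite,linorder}) \<Rightarrow> (int ^ ('d::{finite,linorder})) set \<Rightarrow> nat \<Rightarrow>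
      (real ^ ('d::{finite,linorder}) \<Rightarrow> complex) \<Rightarrow> bool" where
  "sum_rule M D n t \<longleftrightarrow>
     (\<forall>s \<in> D - {0}. \<forall>\<beta> \<in> \<Delta> n.
        multi_deriv \<beta> (\<lambda>\<xi>. t (matrix_inv (transpose (map_matrix of_int M)) *v \<xi>)) (real_vec s) = 0)"

end

theory Submission
  imports Defs
begin

text \<open>
  Symmetry in the sense (a) survives multiplication by an even function, and symmetry in the sense
  (b) survives multiplication by a real-valued one. The function \<open>r = \<bar>m\<^sub>0\<bar>\<^sup>2\<close> is always real, and
  it is even in the sense (a), where \<open>m\<^sub>0 \<xi>\<close> and \<open>m\<^sub>0 (- \<xi>)\<close> differ by a unimodular factor. It
  therefore suffices to correct \<open>m\<^sub>0\<close> by a polynomial in \<open>r\<close>. Now \<open>m\<^sub>0 * cnj (m\<^sub>0 * q) = r * q\<close> for real \<open>q\<close>, so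
  \<open>q\<close> should invert \<open>r\<close> up to order \<open>n\<close> at the origin. As \<open>r 0 = 1\<close>, a truncated Neumann series
  does this: with \<open>q = (\<Sum>i\<le>n. (1 - r) ^ i)\<close> the error is exactly \<open>1 - r * q = (1 - r) ^ (n + 1)\<close>.

  The error is a power of a trigonometric polynomial that vanishes at \<open>0\<close>. Each derivative lowers
  the exponent of such a power by at most one and produces another trigonometric polynomial as
  cofactor, so all derivatives of order less than \<open>n\<close> vanish at \<open>0\<close>
  (\<open>multi_deriv_power_eq_0\<close>). Trigonometric polynomials are handled as an algebra that is
  closed under conjugation and differentiation.
\<close>

section \<open>The algebra of trigonometric polynomials\<close>

definition trig_char :: "int ^ 'd \<Rightarrow> real ^ 'd \<Rightarrow> complex" where
  "trig_char k \<xi> = exp (2 * of_real pi * \<i> * of_real (real_vec k \<bullet> \<xi>))"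

lemma real_vec_add: "real_vec (k + l) = real_vec k + real_vec l"
  by (simp add: real_vec_def vec_eq_iff)

lemma real_vec_minus: "real_vec (- k) = - real_vec k"
  by (simp add: real_vec_def vec_eq_iff)

lemma real_vec_0: "real_vec 0 = 0"
  by (simp add: real_vec_def vec_eq_iff)

lemma trig_char_add: "trig_char (k + l) \<xi> = trig_char k \<xi> * trig_char l \<xi>"
  by (simp add: trig_char_def real_vec_add inner_add_left distrib_left exp_add)

lemma cnj_trig_char: "cnj (trig_char k \<xi>) = trig_char (- k) \<xi>"
  by (simp add: trig_char_def real_vec_minus exp_cnj)

text \<open>
  The definition of \<open>trig_poly\<close> sums over the exact support of the coefficients. Supports shrink
  when terms cancel, so closure properties are easier to obtain from sums over any finite set.
\<close>

lemma trig_poly_iff: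
  "trig_poly t \<longleftrightarrow> (\<exists>h S. finite S \<and> t = (\<lambda>\<xi>. \<Sum>k\<in>S. h k * trig_char k \<xi>))"
proof
  assume "trig_poly t"
  then show "\<exists>h S. finite S \<and> t = (\<lambda>\<xi>. \<Sum>k\<in>S. h k * trig_char k \<xi>)"
    unfolding trig_poly_def trig_char_def by blast
next
  assume "\<exists>h S. finite S \<and> t = (\<lambda>\<xi>. \<Sum>k\<in>S. h k * trig_char k \<xi>)"
  then obtain h S where S: "finite S" and t: "t = (\<lambda>\<xi>. \<Sum>k\<in>S. h k * trig_char k \<xi>)"
    by blast
  define g where "g k = (if k \<in> S then h k else 0)" for k
  have supp: "{k. g k \<noteq> 0} \<subseteq> S"
    by (auto simp: g_def)
  have "t \<xi> = (\<Sum>k | g k \<noteq> 0. g k * trig_char k \<xi>)" for \<xi>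
  proof -
    have "t \<xi> = (\<Sum>k\<in>S. g k * trig_char k \<xi>)"
      by (simp add: t g_def)
    also have "\<dots> = (\<Sum>k | g k \<noteq> 0. g k * trig_char k \<xi>)"
      using S supp by (intro sum.mono_neutral_right) auto
    finally show ?thesis .
  qed
  with finite_subset[OF supp S] show "trig_poly t"
    unfolding trig_poly_def trig_char_def by blast
qed

lemma trig_poly_trig_char: "trig_poly (\<lambda>\<xi>. a * trig_char k \<xi>)"
  unfolding trig_poly_iff by (intro exI[of _ "\<lambda>_. a"] exI[of _ "{k}"]) simp

lemma trig_poly_add:
  assumes "trig_poly f" "trig_poly g"
  shows "trig_poly (\<lambda>\<xi>. f \<xi> + g \<xi>)"
proof -
  obtain a S where S: "finite S" and f: "f = (\<lambda>\<xi>. \<Sum>k\<in>S. a k * trig_char k \<xi>)"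
    using assms(1) unfolding trig_poly_iff by blast
  obtain b T where T: "finite T" and g: "g = (\<lambda>\<xi>. \<Sum>k\<in>T. b k * trig_char k \<xi>)"
    using assms(2) unfolding trig_poly_iff by blast
  define h where "h k = (if k \<in> S then a k else 0) + (if k \<in> T then b k else 0)" for k
  have "f \<xi> + g \<xi> = (\<Sum>k\<in>S \<union> T. h k * trig_char k \<xi>)" for \<xi>
  proof -
    have "f \<xi> = (\<Sum>k\<in>S \<union> T. (if k \<in> S then a k else 0) * trig_char k \<xi>)"
      unfolding f using S T by (intro sum.mono_neutral_cong_left) auto
    moreover have "g \<xi> = (\<Sum>k\<in>S \<union> T. (if k \<in> T then b k else 0) * trig_char k \<xi>)"
      unfolding g using S T by (intro sum.mono_neutral_cong_left) auto
    ultimately show ?thesis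
      by (simp add: h_def distrib_right sum.distrib)
  qed
  then show ?thesis
    unfolding trig_poly_iff using S T by blast
qed

lemma trig_poly_const: "trig_poly (\<lambda>\<xi>. a)"
  using trig_poly_trig_char[of a 0] by (simp add: trig_char_def real_vec_0)

lemma trig_poly_sum:
  assumes "\<And>i. i \<in> I \<Longrightarrow> trig_poly (f i)"
  shows "trig_poly (\<lambda>\<xi>. \<Sum>i\<in>I. f i \<xi>)"
  using assms
  by (induction I rule: infinite_finite_induct) (auto intro: trig_poly_add trig_poly_const)

lemma trig_poly_mult:
  assumes "trig_poly f" "trig_poly g"
  shows "trig_poly (\<lambda>\<xi>. f \<xi> * g \<xi>)"
proof -
  obtain a S where f: "f = (\<lambda>\<xi>. \<Sum>k\<in>S. a k * trig_char k \<xi>)"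
    using assms(1) unfolding trig_poly_iff by blast
  obtain b T where g: "g = (\<lambda>\<xi>. \<Sum>k\<in>T. b k * trig_char k \<xi>)"
    using assms(2) unfolding trig_poly_iff by blast
  have "f \<xi> * g \<xi> = (\<Sum>k\<in>S. \<Sum>l\<in>T. (a k * b l) * trig_char (k + l) \<xi>)" for \<xi>
    by (simp add: f g sum_product trig_char_add mult_ac)
  then show ?thesis
    by (simp add: trig_poly_sum trig_poly_trig_char)
qed

lemma trig_poly_power: "trig_poly f \<Longrightarrow> trig_poly (\<lambda>\<xi>. f \<xi> ^ m)"
  by (induction m) (auto intro: trig_poly_mult trig_poly_const)

lemma trig_poly_diff:
  assumes "trig_poly f" "trig_poly g"
  shows "trig_poly (\<lambda>\<xi>. f \<xi> - g \<xi>)"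
  using trig_poly_add[OF assms(1) trig_poly_mult[OF trig_poly_const[of "-1"] assms(2)]] by simp

lemma trig_poly_cnj:
  assumes "trig_poly f"
  shows "trig_poly (\<lambda>\<xi>. cnj (f \<xi>))"
proof -
  obtain a S where f: "f = (\<lambda>\<xi>. \<Sum>k\<in>S. a k * trig_char k \<xi>)"
    using assms unfolding trig_poly_iff by blast
  have "cnj (f \<xi>) = (\<Sum>k\<in>S. cnj (a k) * trig_char (- k) \<xi>)" for \<xi>
    by (simp add: f cnj_trig_char)
  then show ?thesis
    by (simp add: trig_poly_sum trig_poly_trig_char)
qed

section \<open>Derivatives of powers of trigonometric polynomials\<close>

lemma trig_poly_has_partial_deriv:
  assumes "trig_poly f"
  obtains f' where "trig_poly f'"
    "\<And>x. ((\<lambda>u. f (x + u *\<^sub>R axis j 1)) has_vector_derivative f' x) (at 0)"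
proof -
  obtain a S where f: "f = (\<lambda>\<xi>. \<Sum>k\<in>S. a k * trig_char k \<xi>)"
    using assms unfolding trig_poly_iff by blast
  define b where "b k = a k * (2 * of_real pi * \<i> * of_int (k $ j))" for k
  define f' where "f' = (\<lambda>\<xi>. \<Sum>k\<in>S. b k * trig_char k \<xi>)"
  have "trig_poly f'"
    by (simp add: f'_def trig_poly_sum trig_poly_trig_char)
  moreover have "((\<lambda>u. f (x + u *\<^sub>R axis j 1)) has_vector_derivative f' x) (at 0)" for x
    unfolding f f'_def
  proof (rule has_vector_derivative_sum)
    fix k
    have on_line: "a k * trig_char k (x + u *\<^sub>R axis j 1) =
        a k * trig_char k x * exp (of_real u * (2 * of_real pi * \<i> * of_int (k $ j)))" for u
      by (simp add: trig_char_def real_vec_def inner_add_right inner_axis exp_add[symmetric]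
          algebra_simps)
    have "((\<lambda>z. a k * trig_char k x * exp (z * (2 * of_real pi * \<i> * of_int (k $ j))))
        has_field_derivative b k * trig_char k x) (at (of_real 0))"
      by (auto intro!: derivative_eq_intros simp: b_def)
    from has_vector_derivative_real_field[OF this]
    show "((\<lambda>u. a k * trig_char k (x + u *\<^sub>R axis j 1))
        has_vector_derivative b k * trig_char k x) (at 0)"
      by (simp add: on_line)
  qed
  ultimately show thesis
    by (rule that)
qed

text \<open>
  The cofactor \<open>v\<close> is left unspecified because it changes with every derivative; membership in the
  algebra is all that the next derivative requires.
\<close>

lemma partial_deriv_mult_power:
  assumes u: "trig_poly u" and w: "trig_poly w"
  obtains v where "trig_poly v" "partial_deriv j (\<lambda>\<xi>. u \<xi> * w \<xi> ^ Suc m) = (\<lambda>\<xi>. v \<xi> * w \<xi> ^ m)"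
proof -
  obtain u' where u': "trig_poly u'"
    "\<And>x. ((\<lambda>s. u (x + s *\<^sub>R axis j 1)) has_vector_derivative u' x) (at 0)"
    using trig_poly_has_partial_deriv[OF u, of j] by blast
  obtain w' where w': "trig_poly w'"
    "\<And>x. ((\<lambda>s. w (x + s *\<^sub>R axis j 1)) has_vector_derivative w' x) (at 0)"
    using trig_poly_has_partial_deriv[OF w, of j] by blast
  define v where "v = (\<lambda>\<xi>. u' \<xi> * w \<xi> + of_nat (Suc m) * u \<xi> * w' \<xi>)"
  have "trig_poly v"
    unfolding v_def by (intro trig_poly_add trig_poly_mult trig_poly_const u u' w w')
  moreover have "partial_deriv j (\<lambda>\<xi>. u \<xi> * w \<xi> ^ Suc m) x = v x * w x ^ m" for x
  proof -
    have pow: "((\<lambda>s. w (x + s *\<^sub>R axis j 1) ^ Suc m) has_vector_derivative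
        of_nat (Suc m) * w x ^ m * w' x) (at 0)"
      using has_derivative_power[OF w'(2)[of x, unfolded has_vector_derivative_def], of "Suc m"]
      unfolding has_vector_derivative_def by (simp add: scaleR_conv_of_real mult_ac)
    have "((\<lambda>s. u (x + s *\<^sub>R axis j 1) * w (x + s *\<^sub>R axis j 1) ^ Suc m)
        has_vector_derivative v x * w x ^ m) (at 0)"
      using has_vector_derivative_mult[OF u'(2)[of x] pow]
      by (simp add: v_def algebra_simps)
    then show ?thesis
      unfolding partial_deriv_def by (rule vector_derivative_at)
  qed
  ultimately show thesis
    using that by blast
qed

lemma funpow_partial_deriv_mult_power:
  assumes "trig_poly u" "trig_poly w"
  shows "\<exists>v. trig_poly v \<and>
    (partial_deriv j ^^ r) (\<lambda>\<xi>. u \<xi> * w \<xi> ^ (r + m)) = (\<lambda>\<xi>. v \<xi> * w \<xi> ^ m)"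
  using assms(1)
proof (induction r arbitrary: u)
  case 0
  then show ?case by auto
next
  case (Suc r)
  obtain v where "trig_poly v"
    "partial_deriv j (\<lambda>\<xi>. u \<xi> * w \<xi> ^ Suc (r + m)) = (\<lambda>\<xi>. v \<xi> * w \<xi> ^ (r + m))"
    using partial_deriv_mult_power[OF Suc.prems assms(2)] by blast
  with Suc.IH[of v] show ?case
    by (simp add: funpow_Suc_right del: funpow.simps power_Suc)
qed

lemma foldr_partial_deriv_mult_power:
  assumes "trig_poly u" "trig_poly w"
  shows "\<exists>v. trig_poly v \<and>
    foldr (\<lambda>j. partial_deriv j ^^ \<beta> j) js (\<lambda>\<xi>. u \<xi> * w \<xi> ^ (sum_list (map \<beta> js) + m)) =
      (\<lambda>\<xi>. v \<xi> * w \<xi> ^ m)"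
proof (induction js arbitrary: m)
  case Nil
  then show ?case using assms by auto
next
  case (Cons j js)
  obtain v where v: "trig_poly v"
    "foldr (\<lambda>j. partial_deriv j ^^ \<beta> j) js
       (\<lambda>\<xi>. u \<xi> * w \<xi> ^ (sum_list (map \<beta> js) + (\<beta> j + m))) = (\<lambda>\<xi>. v \<xi> * w \<xi> ^ (\<beta> j + m))"
    using Cons.IH by blast
  have "sum_list (map \<beta> (j # js)) + m = sum_list (map \<beta> js) + (\<beta> j + m)"
    by simp
  then show ?case
    using v funpow_partial_deriv_mult_power[OF v(1) assms(2), where j = j and r = "\<beta> j" and m = m]
    by (simp only: foldr.simps o_apply)
qed

text \<open>
  A power with exponent above the order of differentiation keeps at least one factor \<open>w\<close> in
  every derivative.
\<close>

lemma multi_deriv_power_eq_0: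
  fixes w :: "real ^ ('d::{finite,linorder}) \<Rightarrow> complex"
  assumes w: "trig_poly w" "w 0 = 0" and less: "(\<Sum>j\<in>UNIV. \<beta> j) < N"
  shows "multi_deriv \<beta> (\<lambda>\<xi>. w \<xi> ^ N) 0 = 0"
proof -
  let ?js = "sorted_list_of_set (UNIV :: 'd set)"
  have order: "sum_list (map \<beta> ?js) = (\<Sum>j\<in>UNIV. \<beta> j)"
    by (simp add: sum_list_distinct_conv_sum_set)
  define m where "m = N - (\<Sum>j\<in>UNIV. \<beta> j)"
  have m: "sum_list (map \<beta> ?js) + m = N" "m > 0"
    using less by (auto simp: m_def order)
  obtain v where "multi_deriv \<beta> (\<lambda>\<xi>. 1 * w \<xi> ^ N) = (\<lambda>\<xi>. v \<xi> * w \<xi> ^ m)"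
    using foldr_partial_deriv_mult_power[OF trig_poly_const[of 1] w(1), where \<beta> = \<beta> and js = ?js and m = m]
    unfolding multi_deriv_def m(1) by blast
  then show ?thesis
    using w(2) m(2) by simp
qed

section \<open>The dual mask\<close>

lemma symmetric_a_mult_even:
  assumes "symmetric_a c t" "\<And>\<xi>. q (- \<xi>) = q \<xi>"
  shows "symmetric_a c (\<lambda>\<xi>. t \<xi> * q \<xi>)"
  using assms unfolding symmetric_a_def by (metis mult.assoc)

lemma symmetric_b_mult_real:
  assumes "symmetric_b c t" "\<And>\<xi>. cnj (q \<xi>) = q \<xi>"
  shows "symmetric_b c (\<lambda>\<xi>. t \<xi> * q \<xi>)"
  using assms unfolding symmetric_b_def by (metis complex_cnj_mult mult.assoc)

lemma symmetric_a_abs_square_even: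
  assumes "symmetric_a c t"
  shows "t (- \<xi>) * cnj (t (- \<xi>)) = t \<xi> * cnj (t \<xi>)"
proof -
  have "cmod (t \<xi>) =
      cmod (exp (2 * of_real pi * \<i> * of_real ((2 *\<^sub>R c) \<bullet> \<xi>)) * t (- \<xi>))"
    using assms unfolding symmetric_a_def by metis
  also have "\<dots> = cmod (t (- \<xi>))"
    by (simp add: norm_mult norm_exp_eq_Re)
  finally show ?thesis
    by (simp add: complex_norm_square[symmetric])
qed

theorem theorem18:
  fixes M :: "int ^ ('d::{finite,linorder}) ^ ('d::{finite,linorder})"
    and D :: "(int ^ ('d::{finite,linorder})) set"
    and c :: "real ^ ('d::{finite,linorder})"
    and n :: nat
    and m\<^sub>0 :: "real ^ ('d::{finite,linorder}) \<Rightarrow> complex"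
  assumes "matrix_dilation M"
    and "digits (transpose M) D"
    and "half_integer_point c"
    and "is_mask m\<^sub>0"
    and "sum_rule M D n m\<^sub>0"
  shows "(symmetric_a c m\<^sub>0 \<longrightarrow>
           (\<exists>m'. is_mask m' \<and> symmetric_a c m' \<and>
             (\<forall>\<beta> \<in> \<Delta> n. multi_deriv \<beta> (\<lambda>\<xi>. 1 - m\<^sub>0 \<xi> * cnj (m' \<xi>)) 0 = 0))) \<and>
         (symmetric_b c m\<^sub>0 \<longrightarrow>
           (\<exists>m'. is_mask m' \<and> symmetric_b c m' \<and>
             (\<forall>\<beta> \<in> \<Delta> n. multi_deriv \<beta> (\<lambda>\<xi>. 1 - m\<^sub>0 \<xi> * cnj (m' \<xi>)) 0 = 0)))"
proof -
  define w where "w \<xi> = 1 - m\<^sub>0 \<xi> * cnj (m\<^sub>0 \<xi>)" for \<xi>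
  \<comment> \<open>The range of the sum is never empty, so that \<open>q 0 = 1\<close> also for \<open>n = 0\<close>.\<close>
  define q where "q \<xi> = (\<Sum>i<Suc n. w \<xi> ^ i)" for \<xi>
  define m' where "m' \<xi> = m\<^sub>0 \<xi> * q \<xi>" for \<xi>
  have m0: "trig_poly m\<^sub>0" "m\<^sub>0 0 = 1"
    using \<open>is_mask m\<^sub>0\<close> by (auto simp: is_mask_def)
  have w: "trig_poly w" "w 0 = 0"
    unfolding w_def
    by (intro trig_poly_diff trig_poly_const trig_poly_mult trig_poly_cnj m0) (simp add: m0)
  have "trig_poly m'"
    unfolding m'_def q_def by (intro trig_poly_mult trig_poly_sum trig_poly_power m0 w)
  moreover have "q 0 = 1"
    unfolding q_def sum.lessThan_Suc_shift by (simp add: w)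
  ultimately have mask: "is_mask m'"
    by (simp add: is_mask_def m'_def m0)

  have real: "cnj (q \<xi>) = q \<xi>" for \<xi>
    by (simp add: q_def w_def mult.commute)
  have error: "1 - m\<^sub>0 \<xi> * cnj (m' \<xi>) = w \<xi> ^ Suc n" for \<xi>
  proof -
    have "1 - w \<xi> ^ Suc n = (1 - w \<xi>) * q \<xi>"
      unfolding q_def by (rule one_diff_power_eq)
    then show ?thesis
      by (simp add: m'_def real w_def algebra_simps)
  qed
  have flat: "\<forall>\<beta> \<in> \<Delta> n. multi_deriv \<beta> (\<lambda>\<xi>. 1 - m\<^sub>0 \<xi> * cnj (m' \<xi>)) 0 = 0"
    unfolding error \<Delta>_def using multi_deriv_power_eq_0[OF w, of _ "Suc n"] by auto

  have sym_a: "symmetric_a c m'" if "symmetric_a c m\<^sub>0"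
    unfolding m'_def
    by (rule symmetric_a_mult_even[OF that])
      (simp add: q_def w_def symmetric_a_abs_square_even[OF that])
  have sym_b: "symmetric_b c m'" if "symmetric_b c m\<^sub>0"
    unfolding m'_def by (rule symmetric_b_mult_real[OF that real])
  from mask flat sym_a sym_b show ?thesis
    by blast
qed

end
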